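(* Fix an integer $n\geq 2$ and let $f:[0,\infty)\to\mathbb{R}$. Then the following are equivalent: (1) For all positive semidefinite $A,B\in M_n([0,\infty))$: $f[A]\geq f[B]$ if and only if $A\geq B$. (2) For all positive definite $A,B\in M_n([0,\infty))$: $f[A]>f[B]$ if and only if $A>B$. (3) There exist $c>0$ and $d\in\mathbb{R}$ such that $f(x)=cx+d$ for all $x\in[0,\infty)$.
   Context: $M_n([0,\infty))$ denotes the set of $n\times n$ matrices with entries in $[0,\infty)$, and $f[A]:=(f(a_{ij}))$ for $A=(a_{ij})$. Positive (semi)definite matrices are symmetric by definition. For real symmetric matrices $A,B$, $A\geq B$ means $A-B$ is positive semidefinite, and $A>B$ means $A-B$ is positive definite (Loewner ordering). *)

theory Defs
  imports "HOL-Analysis.Analysis"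
begin

definition pos_semidef :: "real^'n^'n \<Rightarrow> bool" where
  "pos_semidef A \<longleftrightarrow> transpose A = A \<and> (\<forall>x. 0 \<le> x \<bullet> (A *v x))"

definition pos_def :: "real^'n^'n \<Rightarrow> bool" where
  "pos_def A \<longleftrightarrow> transpose A = A \<and> (\<forall>x. x \<noteq> 0 \<longrightarrow> 0 < x \<bullet> (A *v x))"

text \<open>The Loewner ordering. The library's order on \<^typ>\<open>real^'n^'n\<close> is entrywise, so
  separate symbols are used. Both are meant for symmetric arguments.\<close>

definition loewner_ge :: "real^'n^'n \<Rightarrow> real^'n^'n \<Rightarrow> bool"  (infix "\<ge>\<^sub>L" 50) where
  "A \<ge>\<^sub>L B \<longleftrightarrow> pos_semidef (A - B)"

definition loewner_gt :: "real^'n^'n \<Rightarrow> real^'n^'n \<Rightarrow> bool"  (infix ">\<^sub>L" 50) where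
  "A >\<^sub>L B \<longleftrightarrow> pos_def (A - B)"

definition nonneg_entries :: "real^'n^'n \<Rightarrow> bool" where
  "nonneg_entries A \<longleftrightarrow> (\<forall>i j. 0 \<le> A $ i $ j)"

end

theory Submission
  imports Defs
begin

text \<open>The only test matrices needed are \<open>2 \<times> 2\<close> blocks with diagonal \<open>(a, a)\<close> and off-diagonal
  entry \<open>b\<close>, extended by a multiple of the identity; such a block is positive semidefinite iff
  \<open>\<bar>b\<bar> \<le> a\<close>. Comparing the blocks \<open>(a + h, b + k)\<close> and \<open>(a, b)\<close> with \<open>b < a\<close>, the preservation
  of the order for \<open>k < h\<close> and its reflection for \<open>h < k\<close> bound the increment of \<open>f\<close> at \<open>a\<close> by
  that at \<open>b\<close> from both sides. As \<open>k\<close> approaches \<open>h\<close>, the increments \<open>f (x + h) - f x\<close> turn out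
  to be independent of \<open>x > 0\<close>, so \<open>f\<close> is affine by Cauchy's functional equation.\<close>

subsection \<open>Affine functions from their increments\<close>

text \<open>Nonnegativity makes an additive \<open>G\<close> monotone. Squeezing
  \<open>n * x\<close> between consecutive integers then bounds
  \<open>n * \<bar>G x - x * G 1\<bar>\<close> by \<open>G 1\<close> for every \<open>n\<close>,
  which forces the deviation to vanish.\<close>

lemma additive_increasing_imp_linear:
  fixes G :: "real \<Rightarrow> real"
  assumes add: "\<And>x y. x \<ge> 0 \<Longrightarrow> y \<ge> 0 \<Longrightarrow> G (x + y) = G x + G y"
    and pos: "\<And>x. x \<ge> 0 \<Longrightarrow> G x \<ge> 0"
    and "x \<ge> 0"
  shows "G x = x * G 1"
proof -
  have mult: "G (of_nat m * y) = of_nat m * G y" if "y \<ge> 0" for m :: nat and y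
  proof (induction m)
    case 0
    show ?case using add[of 0 0] by simp
  next
    case (Suc m)
    then show ?case
      using add[of y "of_nat m * y"] that by (simp add: algebra_simps)
  qed
  have mono: "G y \<le> G z" if "0 \<le> y" "y \<le> z" for y z
    using add[of y "z - y"] pos[of "z - y"] that by simp
  have approx: "of_nat n * \<bar>G x - x * G 1\<bar> \<le> G 1" for n :: nat
  proof -
    define m where "m = nat \<lfloor>of_nat n * x\<rfloor>"
    have m: "of_nat m \<le> of_nat n * x" "of_nat n * x \<le> of_nat m + 1"
      unfolding m_def using \<open>x \<ge> 0\<close> by auto
    have "of_nat m * G 1 \<le> of_nat n * G x"
      using mono[of "of_nat m" "of_nat n * x"] mult[of 1 m] mult[of x n] m \<open>x \<ge> 0\<close> by simp
    moreover have "of_nat n * G x \<le> (of_nat m + 1) * G 1"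
      using mono[of "of_nat n * x" "of_nat (Suc m)"] mult[of 1 "Suc m"] mult[of x n] m \<open>x \<ge> 0\<close>
      by (simp add: algebra_simps)
    moreover have "of_nat m * G 1 \<le> of_nat n * x * G 1" "of_nat n * x * G 1 \<le> (of_nat m + 1) * G 1"
      using m pos[of 1] by (auto intro: mult_right_mono)
    ultimately have "\<bar>of_nat n * G x - of_nat n * x * G 1\<bar> \<le> G 1"
      by (simp add: algebra_simps)
    then have "\<bar>of_nat n * (G x - x * G 1)\<bar> \<le> G 1"
      by (simp add: algebra_simps)
    then show ?thesis by (simp add: abs_mult)
  qed
  show ?thesis
  proof (rule ccontr)
    assume "G x \<noteq> x * G 1"
    then obtain n :: nat where "G 1 < of_nat n * \<bar>G x - x * G 1\<bar>"
      using reals_Archimedean3[of "\<bar>G x - x * G 1\<bar>"] by auto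
    then show False using approx[of n] by linarith
  qed
qed

text \<open>Common core of the semidefinite and the definite case. The strict gaps between
  \<open>h\<close> and \<open>k\<close> make the hypotheses derivable in both;
  \<open>b + k < a + h\<close> keeps the test block definite. Monotonicity is asked for positive
  arguments only, since definite matrices have positive diagonals.\<close>

lemma affine_if_increments_comparable:
  fixes f :: "real \<Rightarrow> real"
  assumes mono: "\<And>x y. 0 < x \<Longrightarrow> x < y \<Longrightarrow> f x < f y"
    and lower: "\<And>a b h k. 0 \<le> b \<Longrightarrow> b < a \<Longrightarrow> 0 \<le> k \<Longrightarrow> k < h \<Longrightarrow>
      \<bar>f (b + k) - f b\<bar> \<le> f (a + h) - f a"
    and upper: "\<And>a b h k. 0 \<le> b \<Longrightarrow> b < a \<Longrightarrow> 0 \<le> h \<Longrightarrow> h < k \<Longrightarrow> b + k < a + h \<Longrightarrow>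
      f (a + h) - f a \<le> \<bar>f (b + k) - f b\<bar>"
  shows "\<exists>c d. c > 0 \<and> (\<forall>x\<ge>0. f x = c * x + d)"
proof -
  have mono': "f x \<le> f y" if "0 < x" "x \<le> y" for x y
    using mono[of x y] that by (cases "x = y") auto
  \<comment> \<open>By \<open>lower\<close>, the increment over a short interval starting at
    \<open>x\<close> is at most that over each of many longer disjoint intervals to its right. Their
    increments add up to less than \<open>f (x + 1) - f x\<close>, so the first one must be
    small.\<close>
  have right_cont: "\<exists>\<delta>>0. f (x + \<delta>) - f x \<le> \<epsilon>" if "x > 0" "\<epsilon> > 0" for x \<epsilon>
  proof -
    obtain m :: nat where m: "f (x + 1) - f x < of_nat m * \<epsilon>"
      using reals_Archimedean3[OF \<open>\<epsilon> > 0\<close>] by blast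
    have "m > 0"
      using m mono[of x "x + 1"] that by (cases m) auto
    \<comment> \<open>One interval of length \<open>k\<close> followed by \<open>m\<close> of length
      \<open>2 * k\<close> exactly fills [x, x + 1]. The doubled length provides the strict
      inequality required by \<open>lower\<close>.\<close>
    define k where "k = 1 / (2 * of_nat m + 1 :: real)"
    have k: "k > 0"
      unfolding k_def by (simp add: add_nonneg_pos)
    have "k + 2 * k * of_nat m = k * (2 * of_nat m + 1)"
      by (simp add: algebra_simps)
    also have "\<dots> = 1"
      unfolding k_def using of_nat_0_le_iff[of m, where 'a = real] by (simp del: of_nat_0_le_iff)
    finally have k_sum: "x + k + 2 * k * of_nat m = x + 1" by simp
    have step: "of_nat i * (f (x + k) - f x) \<le> f (x + k + 2 * k * of_nat i) - f (x + k)" for i :: nat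
    proof (induction i)
      case (Suc i)
      have "f (x + k) - f x \<le> f (x + k + 2 * k * of_nat i + 2 * k) - f (x + k + 2 * k * of_nat i)"
        using lower[of x "x + k + 2 * k * of_nat i" k "2 * k"] k \<open>x > 0\<close>
        by (auto simp: add_pos_nonneg)
      then show ?case using Suc by (simp add: algebra_simps)
    qed simp
    have "of_nat m * (f (x + k) - f x) \<le> f (x + 1) - f (x + k)"
      using step[of m] unfolding k_sum .
    also have "\<dots> < of_nat m * \<epsilon>"
      using m mono[of x "x + k"] k \<open>x > 0\<close> by simp
    finally have "f (x + k) - f x \<le> \<epsilon>" using \<open>m > 0\<close> by simp
    then show ?thesis using k by blast
  qed
  \<comment> \<open>Right continuity closes the gap between \<open>h\<close> and \<open>k\<close>:
    it is applied at \<open>b + h\<close> together with \<open>upper\<close>, and at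
    \<open>a + h\<close> together with \<open>lower\<close>.\<close>
  have const: "f (a + h) - f a = f (b + h) - f b" if ab: "0 < b" "b < a" and h: "0 \<le> h" for a b h
  proof (rule antisym)
    show "f (a + h) - f a \<le> f (b + h) - f b"
    proof (rule field_le_epsilon)
      fix \<epsilon> :: real assume "\<epsilon> > 0"
      then obtain \<delta> where \<delta>: "\<delta> > 0" "f (b + h + \<delta>) - f (b + h) \<le> \<epsilon>"
        using right_cont[of "b + h" \<epsilon>] ab h by auto
      \<comment> \<open>The bound by \<open>(a - b) / 2\<close> ensures
        \<open>b + (h + \<eta>) < a + h\<close>, as \<open>upper\<close> demands.\<close>
      define \<eta> where "\<eta> = min \<delta> ((a - b) / 2)"
      have \<eta>: "0 < \<eta>" "\<eta> \<le> \<delta>" "\<eta> < a - b"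
        unfolding \<eta>_def using \<delta> ab by (auto simp: min_def)
      have "f (a + h) - f a \<le> \<bar>f (b + (h + \<eta>)) - f b\<bar>"
        using upper[of b a h "h + \<eta>"] ab h \<eta> by simp
      also have "\<dots> = f (b + h + \<eta>) - f b"
        using mono[of b "b + (h + \<eta>)"] ab h \<eta> by (simp add: algebra_simps)
      also have "\<dots> \<le> f (b + h + \<delta>) - f b"
        using mono'[of "b + h + \<eta>" "b + h + \<delta>"] ab h \<eta> by simp
      finally show "f (a + h) - f a \<le> f (b + h) - f b + \<epsilon>" using \<delta> by simp
    qed
    show "f (b + h) - f b \<le> f (a + h) - f a"
    proof (rule field_le_epsilon)
      fix \<epsilon> :: real assume "\<epsilon> > 0"
      then obtain \<delta> where \<delta>: "\<delta> > 0" "f (a + h + \<delta>) - f (a + h) \<le> \<epsilon>"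
        using right_cont[of "a + h" \<epsilon>] ab h by auto
      then show "f (b + h) - f b \<le> f (a + h) - f a + \<epsilon>"
        using lower[of b a h "h + \<delta>"] ab h by (simp add: algebra_simps)
    qed
  qed
  have const': "f (x + h) - f x = f (1 + h) - f 1" if "x > 0" "h \<ge> 0" for x h
  proof (cases "x = 1")
    case False
    then consider "x < 1" | "1 < x" by linarith
    then show ?thesis
    proof cases
      case 1
      then show ?thesis using const[of x 1 h] that by linarith
    next
      case 2
      then show ?thesis using const[of 1 x h] that by linarith
    qed
  qed simp
  define c where "c = f 2 - f 1"
  have "c > 0" unfolding c_def using mono[of 1 2] by simp
  have G: "f (1 + h) - f 1 = h * c" if "h \<ge> 0" for h
  proof -
    have "f (1 + h) - f 1 = h * (f (1 + 1) - f 1)"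
    proof (rule additive_increasing_imp_linear[where G = "\<lambda>h. f (1 + h) - f 1"])
      fix x y :: real assume "x \<ge> 0" "y \<ge> 0"
      then show "f (1 + (x + y)) - f 1 = f (1 + x) - f 1 + (f (1 + y) - f 1)"
        using const'[of "1 + x" y] by (simp add: algebra_simps)
    qed (use mono' that in auto)
    then show ?thesis by (simp add: c_def)
  qed
  define d where "d = f 1 - c"
  have pos: "f x = c * x + d" if "x > 0" for x
  proof (cases "x \<ge> 1")
    case True
    then show ?thesis using G[of "x - 1"] by (simp add: d_def algebra_simps)
  next
    case False
    then show ?thesis
      using const'[of x "1 - x"] G[of "1 - x"] that by (simp add: d_def algebra_simps)
  qed
  \<comment> \<open>Monotonicity says nothing at 0, but \<open>lower\<close> admits
    \<open>b = 0\<close>. It gives an error of at most \<open>2 * c * k\<close>, and the term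
    \<open>c * k\<close> of \<open>f k\<close> adds a third share, hence \<open>3 * c\<close> in the
    choice of \<open>k\<close>.\<close>
  have "\<bar>d - f 0\<bar> \<le> 0"
  proof (rule field_le_epsilon)
    fix \<epsilon> :: real assume "\<epsilon> > 0"
    define k where "k = \<epsilon> / (3 * c)"
    have k: "k > 0" "3 * (c * k) = \<epsilon>" unfolding k_def using \<open>\<epsilon> > 0\<close> \<open>c > 0\<close> by auto
    have "\<bar>c * k + d - f 0\<bar> \<le> 2 * (c * k)"
      using lower[of 0 1 k "2 * k"] pos[of k] pos[of 1] pos[of "1 + 2 * k"] k
      by (simp add: algebra_simps)
    then show "\<bar>d - f 0\<bar> \<le> 0 + \<epsilon>"
      using k \<open>c > 0\<close> by linarith
  qed
  then have "f x = c * x + d" if "x \<ge> 0" for x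
    using pos[of x] that by (cases "x = 0") auto
  then show ?thesis using \<open>c > 0\<close> by blast
qed

subsection \<open>Test matrices\<close>

definition block_matrix :: "'n \<Rightarrow> 'n \<Rightarrow> real \<Rightarrow> real \<Rightarrow> real \<Rightarrow> real^'n^'n" where
  "block_matrix p q e a b =
    (\<chi> i j. if i = j then (if i = p \<or> i = q then a else e)
      else if i = p \<and> j = q \<or> i = q \<and> j = p then b else 0)"

lemma transpose_block_matrix [simp]: "transpose (block_matrix p q e a b) = block_matrix p q e a b"
  by (auto simp: block_matrix_def transpose_def vec_eq_iff)

lemma nonneg_entries_block_matrix:
  "e \<ge> 0 \<Longrightarrow> a \<ge> 0 \<Longrightarrow> b \<ge> 0 \<Longrightarrow> nonneg_entries (block_matrix p q e a b)"
  by (auto simp: block_matrix_def nonneg_entries_def)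

lemma block_matrix_diff:
  "block_matrix p q e a b - block_matrix p q e' a' b' =
    block_matrix p q (e - e') (a - a') (b - b')"
  by (auto simp: block_matrix_def vec_eq_iff)

text \<open>Applying \<open>f\<close> turns the zero entries into \<open>f 0\<close>, but these
  cancel in the difference, which is therefore again a block matrix whatever \<open>f 0\<close>
  is.\<close>

lemma map_matrix_block_matrix_diff:
  "map_matrix f (block_matrix p q e a b) - map_matrix f (block_matrix p q e' a' b') =
    block_matrix p q (f e - f e') (f a - f a') (f b - f b')"
  by (auto simp: block_matrix_def map_matrix_def vec_eq_iff)

lemma quadratic_form_block_matrix:
  fixes p q :: "'n::finite"
  assumes "p \<noteq> q"
  shows "x \<bullet> (block_matrix p q e a b *v x) =
    a * ((x $ p)\<^sup>2 + (x $ q)\<^sup>2) + 2 * b * (x $ p) * (x $ q) + e * (\<Sum>i\<in>-{p, q}. (x $ i)\<^sup>2)"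
proof -
  have row: "(block_matrix p q e a b *v x) $ i =
      (if i = p then a * x $ p + b * x $ q else if i = q then b * x $ p + a * x $ q else e * x $ i)" for i
  proof -
    \<comment> \<open>The row is split into three terms, each supported at a single column
      \<open>j\<close>, so that every sum collapses.\<close>
    have "(block_matrix p q e a b *v x) $ i =
        (\<Sum>j\<in>UNIV. (if j = i then (if i = p \<or> i = q then a else e) * x $ j else 0) +
          (if j = q then (if i = p then b * x $ j else 0) else 0) +
          (if j = p then (if i = q then b * x $ j else 0) else 0))"
      unfolding matrix_vector_mult_def block_matrix_def
      using assms by (auto intro!: sum.cong)
    also have "\<dots> = (if i = p \<or> i = q then a else e) * x $ i +
        (if i = p then b * x $ q else 0) + (if i = q then b * x $ p else 0)"
      by (simp add: sum.distrib)
    finally show ?thesis using assms by auto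
  qed
  have "x \<bullet> (block_matrix p q e a b *v x) =
      (\<Sum>i\<in>{p, q} \<union> -{p, q}. x $ i * (block_matrix p q e a b *v x) $ i)"
    unfolding inner_vec_def Compl_partition by simp
  also have "\<dots> = (\<Sum>i\<in>{p, q}. x $ i * (block_matrix p q e a b *v x) $ i) +
      (\<Sum>i\<in>-{p, q}. x $ i * (block_matrix p q e a b *v x) $ i)"
    by (rule sum.union_disjoint) auto
  also have "(\<Sum>i\<in>-{p, q}. x $ i * (block_matrix p q e a b *v x) $ i) =
      e * (\<Sum>i\<in>-{p, q}. (x $ i)\<^sup>2)"
    unfolding sum_distrib_left by (rule sum.cong) (auto simp: row power2_eq_square)
  finally show ?thesis
    using assms by (simp add: row power2_eq_square algebra_simps)
qed

text \<open>The inequality between \<open>2 * \<bar>u * v\<bar>\<close> and the sum of squares shows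
  that the smaller eigenvalue \<open>a - \<bar>b\<bar>\<close> bounds the form of the block from
  below.\<close>

lemma block_form_ge:
  fixes a b u v :: real
  shows "(a - \<bar>b\<bar>) * (u\<^sup>2 + v\<^sup>2) \<le> a * (u\<^sup>2 + v\<^sup>2) + 2 * b * u * v"
proof -
  have "2 * \<bar>u * v\<bar> \<le> u\<^sup>2 + v\<^sup>2"
    using sum_squares_bound[of "\<bar>u\<bar>" "\<bar>v\<bar>"] by (simp add: abs_mult)
  then have "\<bar>b\<bar> * (2 * \<bar>u * v\<bar>) \<le> \<bar>b\<bar> * (u\<^sup>2 + v\<^sup>2)"
    by (intro mult_left_mono) auto
  moreover have "- (2 * b * u * v) \<le> \<bar>b\<bar> * (2 * \<bar>u * v\<bar>)"
    using abs_ge_minus_self[of "2 * b * u * v"] by (simp add: abs_mult mult_ac)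
  ultimately show ?thesis by (simp add: algebra_simps)
qed

lemma pos_semidef_block_matrix:
  fixes p q :: "'n::finite"
  assumes "p \<noteq> q" "e \<ge> 0"
  shows "pos_semidef (block_matrix p q e a b) \<longleftrightarrow> \<bar>b\<bar> \<le> a"
proof
  assume psd: "pos_semidef (block_matrix p q e a b)"
  \<comment> \<open>For \<open>s = 1\<close> and \<open>s = -1\<close> these vectors are
    eigenvectors of the block, with eigenvalues \<open>a + b\<close> and
    \<open>a - b\<close>.\<close>
  have "0 \<le> (\<chi> i. if i = p then 1 else if i = q then s else 0) \<bullet>
      (block_matrix p q e a b *v (\<chi> i. if i = p then 1 else if i = q then s else 0))" for s :: real
    using psd by (simp add: pos_semidef_def)
  then have "0 \<le> a * (1 + s\<^sup>2) + 2 * b * s" for s :: real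
    using assms by (simp add: quadratic_form_block_matrix)
  from this[of 1] this[of "-1"] show "\<bar>b\<bar> \<le> a" by simp
next
  assume "\<bar>b\<bar> \<le> a"
  then have "0 \<le> (a - \<bar>b\<bar>) * (u\<^sup>2 + v\<^sup>2)" for u v :: real by simp
  then have "0 \<le> a * (u\<^sup>2 + v\<^sup>2) + 2 * b * u * v" for u v :: real
    using block_form_ge order_trans by blast
  then show "pos_semidef (block_matrix p q e a b)"
    using assms by (simp add: pos_semidef_def quadratic_form_block_matrix sum_nonneg)
qed

text \<open>Stated for arbitrary \<open>e\<close> so that it applies to \<open>e = f y - f x\<close>
  before \<open>f\<close> is known to be increasing.\<close>

lemma pos_def_block_matrixD:
  fixes p q :: "'n::finite"
  assumes "p \<noteq> q" and pd: "pos_def (block_matrix p q e a b)"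
  shows "\<bar>b\<bar> < a"
proof -
  have "0 < a * (1 + s\<^sup>2) + 2 * b * s" for s :: real
  proof -
    define x :: "real^'n" where "x = (\<chi> i. if i = p then 1 else if i = q then s else 0)"
    have "x \<noteq> 0" by (auto simp: x_def vec_eq_iff)
    then have "0 < x \<bullet> (block_matrix p q e a b *v x)"
      using pd by (simp add: pos_def_def)
    then show ?thesis
      using assms by (simp add: quadratic_form_block_matrix x_def)
  qed
  from this[of 1] this[of "-1"] show "\<bar>b\<bar> < a" by simp
qed

lemma pos_def_block_matrixI:
  fixes p q :: "'n::finite"
  assumes "p \<noteq> q" "e > 0" "\<bar>b\<bar> < a"
  shows "pos_def (block_matrix p q e a b)"
  unfolding pos_def_def
proof (intro conjI allI impI)
  fix x :: "real^'n" assume "x \<noteq> 0"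
  then obtain i where i: "x $ i \<noteq> 0" by (auto simp: vec_eq_iff)
  define S where "S = (\<Sum>i\<in>-{p, q}. (x $ i)\<^sup>2)"
  define T where "T = (x $ p)\<^sup>2 + (x $ q)\<^sup>2"
  have nonneg: "S \<ge> 0" "T \<ge> 0" unfolding S_def T_def by (auto intro: sum_nonneg)
  have "S > 0 \<or> T > 0"
  proof (cases "i = p \<or> i = q")
    case True
    then have "T > 0" unfolding T_def using i by (auto simp: add_pos_nonneg add_nonneg_pos)
    then show ?thesis ..
  next
    case False
    then have "(x $ i)\<^sup>2 \<le> S"
      unfolding S_def by (intro member_le_sum) auto
    moreover have "(x $ i)\<^sup>2 > 0" using i by simp
    ultimately show ?thesis by linarith
  qed
  then have "0 < (a - \<bar>b\<bar>) * T + e * S"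
    using nonneg assms by (auto simp: add_pos_nonneg add_nonneg_pos)
  then show "0 < x \<bullet> (block_matrix p q e a b *v x)"
    using block_form_ge[of a b "x $ p" "x $ q"] assms
    by (simp add: quadratic_form_block_matrix S_def T_def)
qed simp

lemma pos_def_block_matrix:
  fixes p q :: "'n::finite"
  assumes "p \<noteq> q" "e > 0"
  shows "pos_def (block_matrix p q e a b) \<longleftrightarrow> \<bar>b\<bar> < a"
  using pos_def_block_matrixD[OF assms(1)] pos_def_block_matrixI[OF assms] by (rule iffI)

subsection \<open>The characterization\<close>

text \<open>With \<open>e = 0\<close> in both matrices, the differences vanish outside the block
  before and after applying \<open>f\<close>, so the block alone decides the order.\<close>

lemma affine_if_psd_order_embedding:
  fixes f :: "real \<Rightarrow> real" and p q :: "'n::finite"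
  assumes pq: "p \<noteq> q"
    and order: "\<And>A B :: real^'n^'n. pos_semidef A \<Longrightarrow> nonneg_entries A \<Longrightarrow>
      pos_semidef B \<Longrightarrow> nonneg_entries B \<Longrightarrow> map_matrix f A \<ge>\<^sub>L map_matrix f B \<longleftrightarrow> A \<ge>\<^sub>L B"
  shows "\<exists>c d. c > 0 \<and> (\<forall>x\<ge>0. f x = c * x + d)"
proof -
  have key: "\<bar>f b - f b'\<bar> \<le> f a - f a' \<longleftrightarrow> \<bar>b - b'\<bar> \<le> a - a'"
    if "0 \<le> b" "b \<le> a" "0 \<le> b'" "b' \<le> a'" for a b a' b'
    using order[of "block_matrix p q 0 a b" "block_matrix p q 0 a' b'"] that pq
    by (simp add: loewner_ge_def block_matrix_diff map_matrix_block_matrix_diff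
        pos_semidef_block_matrix nonneg_entries_block_matrix)
  show ?thesis
  proof (rule affine_if_increments_comparable)
    \<comment> \<open>With off-diagonal entries 0, \<open>key\<close> says that
      \<open>f x \<ge> f y\<close> iff \<open>x \<ge> y\<close>; its contrapositive yields
      strictness.\<close>
    show "f x < f y" if "0 < x" "x < y" for x y
      using key[of 0 x 0 y] that by auto
    show "\<bar>f (b + k) - f b\<bar> \<le> f (a + h) - f a"
      if "0 \<le> b" "b < a" "0 \<le> k" "k < h" for a b h k
      using key[of "b + k" "a + h" b a] that by simp
    show "f (a + h) - f a \<le> \<bar>f (b + k) - f b\<bar>"
      if "0 \<le> b" "b < a" "0 \<le> h" "h < k" "b + k < a + h" for a b h k
      using key[of "b + k" "a + h" b a] that by auto
  qed
qed

text \<open>Definite differences need a positive diagonal outside the block as well. Multiples of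
  the identity first show that \<open>f\<close> is increasing; then the values 2 and 1 for
  \<open>e\<close> work, because \<open>f 2 - f 1 > 0\<close>.\<close>

lemma affine_if_pd_order_embedding:
  fixes f :: "real \<Rightarrow> real" and p q :: "'n::finite"
  assumes pq: "p \<noteq> q"
    and order: "\<And>A B :: real^'n^'n. pos_def A \<Longrightarrow> nonneg_entries A \<Longrightarrow>
      pos_def B \<Longrightarrow> nonneg_entries B \<Longrightarrow> map_matrix f A >\<^sub>L map_matrix f B \<longleftrightarrow> A >\<^sub>L B"
  shows "\<exists>c d. c > 0 \<and> (\<forall>x\<ge>0. f x = c * x + d)"
proof -
  have mono: "f x < f y" if "0 < x" "x < y" for x y
  proof -
    have "pos_def (block_matrix p q (f y - f x) (f y - f x) (f 0 - f 0))"
      using order[of "block_matrix p q y y 0" "block_matrix p q x x 0"] that pq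
      by (simp add: loewner_gt_def block_matrix_diff map_matrix_block_matrix_diff
          pos_def_block_matrix nonneg_entries_block_matrix)
    then show ?thesis using pos_def_block_matrixD[OF pq] by fastforce
  qed
  have key: "\<bar>f b - f b'\<bar> < f a - f a' \<longleftrightarrow> \<bar>b - b'\<bar> < a - a'"
    if "0 \<le> b" "b < a" "0 \<le> b'" "b' < a'" for a b a' b'
    using order[of "block_matrix p q 2 a b" "block_matrix p q 1 a' b'"] that pq mono[of 1 2]
    by (simp add: loewner_gt_def block_matrix_diff map_matrix_block_matrix_diff
        pos_def_block_matrix nonneg_entries_block_matrix)
  show ?thesis
  proof (rule affine_if_increments_comparable)
    show "f x < f y" if "0 < x" "x < y" for x y
      using that by (rule mono)
    show "\<bar>f (b + k) - f b\<bar> \<le> f (a + h) - f a"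
      if "0 \<le> b" "b < a" "0 \<le> k" "k < h" for a b h k
      using key[of "b + k" "a + h" b a] that by simp
    show "f (a + h) - f a \<le> \<bar>f (b + k) - f b\<bar>"
      if "0 \<le> b" "b < a" "0 \<le> h" "h < k" "b + k < a + h" for a b h k
      using key[of "b + k" "a + h" b a] that by auto
  qed
qed

lemma map_matrix_affine_diff:
  fixes A B :: "real^'n^'n"
  assumes "\<And>x. x \<ge> 0 \<Longrightarrow> f x = c * x + d" "nonneg_entries A" "nonneg_entries B"
  shows "map_matrix f A - map_matrix f B = c *\<^sub>R (A - B)"
  using assms by (auto simp: map_matrix_def nonneg_entries_def vec_eq_iff algebra_simps)

lemma transpose_scaleR_eq_iff:
  fixes A :: "real^'n^'n"
  shows "c > 0 \<Longrightarrow> transpose (c *\<^sub>R A) = c *\<^sub>R A \<longleftrightarrow> transpose A = A"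
  by (simp add: transpose_def vec_eq_iff)

lemma pos_semidef_scaleR_iff: "c > 0 \<Longrightarrow> pos_semidef (c *\<^sub>R A) \<longleftrightarrow> pos_semidef A"
  by (simp add: pos_semidef_def transpose_scaleR_eq_iff scaleR_matrix_vector_assoc[symmetric]
      zero_le_mult_iff)

lemma pos_def_scaleR_iff: "c > 0 \<Longrightarrow> pos_def (c *\<^sub>R A) \<longleftrightarrow> pos_def A"
  by (simp add: pos_def_def transpose_scaleR_eq_iff scaleR_matrix_vector_assoc[symmetric]
      zero_less_mult_iff)

theorem theorem7p1:
  fixes f :: "real \<Rightarrow> real"
  assumes "CARD('n::finite) \<ge> 2"
  defines "P1 \<equiv> (\<forall>A B :: real^'n^'n.
      pos_semidef A \<and> nonneg_entries A \<and> pos_semidef B \<and> nonneg_entries B \<longrightarrow>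
      (map_matrix f A \<ge>\<^sub>L map_matrix f B \<longleftrightarrow> A \<ge>\<^sub>L B))"
  defines "P2 \<equiv> (\<forall>A B :: real^'n^'n.
      pos_def A \<and> nonneg_entries A \<and> pos_def B \<and> nonneg_entries B \<longrightarrow>
      (map_matrix f A >\<^sub>L map_matrix f B \<longleftrightarrow> A >\<^sub>L B))"
  defines "P3 \<equiv> (\<exists>c d. c > 0 \<and> (\<forall>x\<ge>0. f x = c * x + d))"
  shows "(P1 \<longleftrightarrow> P2) \<and> (P2 \<longleftrightarrow> P3)"
proof -
  obtain p q :: 'n where pq: "p \<noteq> q"
    using assms(1) by (metis card_2_iff' ex_card)
  have "P1 \<Longrightarrow> P3"
    unfolding P1_def P3_def by (rule affine_if_psd_order_embedding[OF pq]) blast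
  moreover have "P2 \<Longrightarrow> P3"
    unfolding P2_def P3_def by (rule affine_if_pd_order_embedding[OF pq]) blast
  moreover have "P1 \<and> P2" if P3
  proof -
    obtain c d where cd: "c > 0" "\<And>x. x \<ge> 0 \<Longrightarrow> f x = c * x + d"
      using \<open>P3\<close> unfolding P3_def by blast
    show ?thesis
      \<comment> \<open>The constant \<open>d\<close> cancels, so the difference of the images is
        \<open>c\<close> times \<open>A - B\<close>, and scaling by \<open>c > 0\<close> preserves
        and reflects both kinds of positivity.\<close>
      unfolding P1_def P2_def loewner_ge_def loewner_gt_def
      by (simp add: map_matrix_affine_diff[of f c d, OF cd(2)]
          pos_semidef_scaleR_iff pos_def_scaleR_iff cd(1))
  qed
  ultimately show ?thesis by blast
qed

end
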